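(* Let $X$ be an unweighted bipartite graph on an odd number of vertices. If $X$ has a pendent vertex $u$, then local $\epsilon$-uniform mixing relative to the adjacency matrix $A(X)$ does not occur at $u$. In particular, if $X$ (on an odd number of vertices) is a tree or a bipartite unicyclic graph that is not a cycle, then local $\epsilon$-uniform mixing relative to $A(X)$ does not occur at a pendent vertex of $X$.
   Context: Graphs are finite, simple, undirected and connected; unweighted means all edges have weight $1$. A pendent vertex is a vertex of degree $1$. A connected graph on $n$ vertices is unicyclic if it has $n$ edges. Put $U(t)=e^{\mathrm{i}tA(X)}$. $\mathbf{e}_u$ is the characteristic vector of $u$, $\mathbf{1}$ the all-ones vector, $\circ$ the entrywise product. Local $\epsilon$-uniform mixing occurs at $u$ in a graph on $n$ vertices if for each $\epsilon>0$ there is a time $\tau\in\mathbb{R}$ such that $\big\|(U(\tau)\mathbf{e}_u)\circ(\overline{U(\tau)}\mathbf{e}_u)-\tfrac1n\mathbf{1}\big\|<\epsilon$. *)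

theory Defs
  imports "HOL-Analysis.Analysis"
begin

text \<open>
  A graph on the finite vertex type \<open>'v\<close> is given by its adjacency relation;
  every element of \<open>'v\<close> is a vertex, so the number of vertices is \<open>CARD('v)\<close>.
\<close>

definition simple_graph :: "('v \<Rightarrow> 'v \<Rightarrow> bool) \<Rightarrow> bool" where
  "simple_graph adj \<longleftrightarrow> symp adj \<and> irreflp adj"

definition connected_graph :: "('v \<Rightarrow> 'v \<Rightarrow> bool) \<Rightarrow> bool" where
  "connected_graph adj \<longleftrightarrow> (\<forall>u v. adj\<^sup>*\<^sup>* u v)"

definition edges :: "('v \<Rightarrow> 'v \<Rightarrow> bool) \<Rightarrow> 'v set set" where
  "edges adj = {{u, v} | u v. adj u v}"

definition degree :: "('v \<Rightarrow> 'v \<Rightarrow> bool) \<Rightarrow> 'v \<Rightarrow> nat" where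
  "degree adj u = card {v. adj u v}"

definition pendent :: "('v \<Rightarrow> 'v \<Rightarrow> bool) \<Rightarrow> 'v \<Rightarrow> bool" where
  "pendent adj u \<longleftrightarrow> degree adj u = 1"

definition bipartite :: "('v \<Rightarrow> 'v \<Rightarrow> bool) \<Rightarrow> bool" where
  "bipartite adj \<longleftrightarrow>
     (\<exists>S T. S \<union> T = UNIV \<and> S \<inter> T = {} \<and>
        (\<forall>u v. adj u v \<longrightarrow> (u \<in> S \<and> v \<in> T) \<or> (u \<in> T \<and> v \<in> S)))"

definition cycle_edges :: "'v list \<Rightarrow> 'v set set" where
  "cycle_edges c = {{c ! i, c ! (Suc i mod length c)} | i. i < length c}"

definition graph_cycle :: "('v \<Rightarrow> 'v \<Rightarrow> bool) \<Rightarrow> 'v list \<Rightarrow> bool" where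
  "graph_cycle adj c \<longleftrightarrow> 3 \<le> length c \<and> distinct c \<and> cycle_edges c \<subseteq> edges adj"

definition tree :: "('v \<Rightarrow> 'v \<Rightarrow> bool) \<Rightarrow> bool" where
  "tree adj \<longleftrightarrow> simple_graph adj \<and> connected_graph adj \<and> (\<nexists>c. graph_cycle adj c)"

definition unicyclic :: "('v::finite \<Rightarrow> 'v \<Rightarrow> bool) \<Rightarrow> bool" where
  "unicyclic adj \<longleftrightarrow>
     simple_graph adj \<and> connected_graph adj \<and> card (edges adj) = CARD('v)"

text \<open>The graph as a whole is a cycle \<open>C\<^sub>n\<close> with \<open>n \<ge> 3\<close>.\<close>

definition cycle_graph :: "('v \<Rightarrow> 'v \<Rightarrow> bool) \<Rightarrow> bool" where
  "cycle_graph adj \<longleftrightarrow>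
     (\<exists>c. 3 \<le> length c \<and> distinct c \<and> set c = UNIV \<and> edges adj = cycle_edges c)"

definition adjacency_matrix :: "('v::finite \<Rightarrow> 'v \<Rightarrow> bool) \<Rightarrow> complex^'v^'v" where
  "adjacency_matrix adj = (\<chi> u v. if adj u v then 1 else 0)"

text \<open>
  Multiplication and powers on \<open>complex^'n^'n\<close> are the entrywise ones in
  the library, and \<^const>\<open>exp\<close> is not available there, so the exponential
  series is written out with the matrix product \<open>**\<close>.
\<close>

primrec matrix_power :: "'a::semiring_1^'n^'n \<Rightarrow> nat \<Rightarrow> 'a^'n^'n" where
  "matrix_power M 0 = mat 1"
| "matrix_power M (Suc k) = M ** matrix_power M k"

definition matrix_exp :: "complex^'n^'n \<Rightarrow> complex^'n^'n" where
  "matrix_exp M = (\<Sum>k. (1 / fact k) *\<^sub>R matrix_power M k)"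

definition transition_matrix :: "('v::finite \<Rightarrow> 'v \<Rightarrow> bool) \<Rightarrow> real \<Rightarrow> complex^'v^'v" where
  "transition_matrix adj t =
     matrix_exp (map_matrix ((*) (\<i> * of_real t)) (adjacency_matrix adj))"

text \<open>On \<open>complex^'v\<close>, \<open>*\<close> is the entrywise product and \<open>1\<close> the all-ones vector.\<close>

definition local_eps_uniform_mixing :: "('v::finite \<Rightarrow> 'v \<Rightarrow> bool) \<Rightarrow> 'v \<Rightarrow> bool" where
  "local_eps_uniform_mixing adj u \<longleftrightarrow>
     (\<forall>\<epsilon>>0. \<exists>\<tau>::real.
        norm ((transition_matrix adj \<tau> *v axis u 1) *
                (map_matrix cnj (transition_matrix adj \<tau>) *v axis u 1)
              - (1 / real CARD('v)) *\<^sub>R 1) < \<epsilon>)"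

end

theory Submission
  imports Defs
begin

text \<open>Let \<open>w\<close> be the neighbour of \<open>u\<close>. By bipartiteness the entries of \<open>U(t) e\<^sub>u\<close> are, up to a
  factor \<open>\<i>\<close> on one colour class, those of a real unit vector \<open>r\<close>; and \<open>A U(t) e\<^sub>u = U(t) e\<^sub>w\<close>
  gives \<open>\<parallel>A r\<parallel> = 1\<close>. Under mixing, compactness yields such an \<open>r = s / \<surd>n\<close> with \<open>s\<close> a sign vector,
  so \<open>n\<close> is the sum of the integers \<open>((A s)\<^sub>v)\<^sup>2\<close>. These are congruent mod 2 to the degrees,
  whose sum is even, contradicting that \<open>n\<close> is odd.\<close>

section \<open>Trees are bipartite\<close>

text \<open>The stretch between two visits to a vertex closes up by itself, and the stretches before
  and after it join at that vertex. The two lengths add up to \<open>k\<close>, so if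
  \<open>k\<close> is odd, one of them is odd.\<close>

lemma closed_walk_split:
  fixes f :: "nat \<Rightarrow> 'v"
  assumes walk: "\<And>i. i < k \<Longrightarrow> adj (f i) (f (Suc i))" and "f k = f 0"
    and "i < j" "j < k" "f i = f j"
  shows "(adj ^^ (j - i)) (f i) (f i)" and "(adj ^^ (k - (j - i))) (f 0) (f 0)"
proof -
  have seg: "(adj ^^ (b - a)) (f a) (f b)" if "a \<le> b" "b \<le> k" for a b
    unfolding relpowp_fun_conv
    using that walk by (intro exI[of _ "\<lambda>m. f (a + m)"]) auto
  show "(adj ^^ (j - i)) (f i) (f i)"
    using seg[of i j] assms by simp
  have "(adj ^^ (i + (k - j))) (f 0) (f k)"
    using seg[of 0 i] seg[of j k] assms by (intro relpowp_trans[of _ _ _ "f i"]) auto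
  moreover have "i + (k - j) = k - (j - i)"
    using assms by simp
  ultimately show "(adj ^^ (k - (j - i))) (f 0) (f 0)"
    using assms by simp
qed

text \<open>A shortest odd closed walk repeats no vertex, since a repetition splits it into two
  shorter closed walks, one of which is odd.\<close>

lemma odd_closed_walk_imp_cycle:
  assumes "simple_graph adj" and "odd k" and "(adj ^^ k) r r"
  shows "\<exists>c. graph_cycle adj c"
proof -
  define Q where "Q k \<longleftrightarrow> odd k \<and> (\<exists>r. (adj ^^ k) r r)" for k
  define m where "m = (LEAST k. Q k)"
  have "Q k" unfolding Q_def using assms by auto
  hence Qm: "Q m" and least: "\<And>k. Q k \<Longrightarrow> m \<le> k"
    unfolding m_def by (auto intro: LeastI Least_le)
  from Qm obtain f where f: "f m = f 0" "\<And>i. i < m \<Longrightarrow> adj (f i) (f (Suc i))"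
    unfolding Q_def relpowp_fun_conv by auto
  have oddm: "odd m" using Qm Q_def by simp
  \<comment> \<open>A closed walk of length 1 would be a loop. With oddness this leaves length at
    least 3, the minimum in \<open>graph_cycle\<close>.\<close>
  have "m \<noteq> 1"
    using f assms(1) by (auto simp: simple_graph_def irreflp_def)
  with oddm have m3: "3 \<le> m"
    by presburger
  have inj: "f i \<noteq> f j" if "i < j" "j < m" for i j
  proof
    assume "f i = f j"
    note split = closed_walk_split[of m adj f i j, OF f(2) f(1) that this]
    have "Q (j - i) \<or> Q (m - (j - i))"
      unfolding Q_def using split oddm that by auto
    thus False
      using least[of "j - i"] least[of "m - (j - i)"] that by auto
  qed
  define c where "c = map f [0..<m]"
  have "distinct c"
    unfolding c_def distinct_map inj_on_def using inj by (auto, metis linorder_neqE_nat)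
  moreover have "cycle_edges c \<subseteq> edges adj"
  proof -
    have "{c ! i, c ! (Suc i mod m)} \<in> edges adj" if "i < m" for i
    proof -
      \<comment> \<open>At the last index the modulus wraps to 0, and \<open>f m = f 0\<close>
        supplies the closing edge.\<close>
      have "c ! (Suc i mod m) = f (Suc i)"
        using that f(1) m3 by (cases "Suc i = m") (auto simp: c_def)
      thus ?thesis
        unfolding edges_def using that f(2)[OF that] by (auto simp: c_def)
    qed
    thus ?thesis
      unfolding cycle_edges_def by (auto simp: c_def)
  qed
  ultimately have "graph_cycle adj c"
    using m3 by (simp add: graph_cycle_def c_def)
  thus ?thesis ..
qed

text \<open>Vertices are coloured by the parity of walks from a root; an edge inside one class would
  create an odd closed walk, hence a cycle.\<close>

lemma tree_imp_bipartite:
  assumes "tree adj"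
  shows "bipartite adj"
proof -
  have simple: "simple_graph adj" and conn: "connected_graph adj" and acyc: "\<nexists>c. graph_cycle adj c"
    using assms by (auto simp: tree_def)
  have sym: "adj y x" if "adj x y" for x y
    using simple that by (auto simp: simple_graph_def dest: sympD)
  have no_odd: "\<not> (adj ^^ k) r r" if "odd k" for k r
    using odd_closed_walk_imp_cycle[OF simple that] acyc by blast
  have rev: "(adj ^^ k) y x" if "(adj ^^ k) x y" for k x y
    using that
  proof (induction k arbitrary: y)
    case (Suc k)
    then obtain z where "(adj ^^ k) x z" "adj z y" by auto
    then show ?case
      using Suc.IH sym by (metis relpowp_Suc_I2)
  qed auto
  have same_parity: False
    if "(adj ^^ k) r x" "(adj ^^ l) r y" "adj x y" "even k \<longleftrightarrow> even l" for k l r x y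
  proof -
    \<comment> \<open>Walk out to \<open>x\<close>, cross to \<open>y\<close>, and return along the
      reversed second walk.\<close>
    have "(adj ^^ (Suc k + l)) r r"
      using that rev[OF that(2)] by (intro relpowp_trans[of _ _ _ y]) auto
    thus False
      using no_odd[of "Suc k + l" r] that(4) by simp
  qed
  \<comment> \<open>The root is arbitrary, since connectedness gives a walk from it to every
    vertex.\<close>
  fix r :: 'a
  define S where "S = {x. \<exists>k. even k \<and> (adj ^^ k) r x}"
  have walk: "\<exists>k. (even k \<longleftrightarrow> x \<in> S) \<and> (adj ^^ k) r x" for x
  proof (cases "x \<in> S")
    case False
    obtain k where "(adj ^^ k) r x"
      using conn rtranclp_imp_relpowp by (metis connected_graph_def)
    with False show ?thesis unfolding S_def by auto
  qed (auto simp: S_def)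
  have "x \<in> S \<longleftrightarrow> y \<notin> S" if "adj x y" for x y
    using walk[of x] walk[of y] same_parity[OF _ _ that] by metis
  thus ?thesis
    unfolding bipartite_def by (intro exI[of _ S] exI[of _ "- S"]) auto
qed

section \<open>The matrix exponential\<close>

text \<open>A crude geometric bound, enough to dominate the exponential series of a matrix by a
  scalar one.\<close>

lemma norm_matrix_power_entry_le:
  fixes M :: "complex^'n^'n"
  shows "norm (matrix_power M k $ i $ j) \<le> (real CARD('n) * norm M) ^ k"
proof (induction k arbitrary: i j)
  case 0
  show ?case by (simp add: mat_def)
next
  case (Suc k)
  have "norm (matrix_power M (Suc k) $ i $ j)
      \<le> (\<Sum>l\<in>UNIV. norm (M $ i $ l * matrix_power M k $ l $ j))"
    by (simp add: matrix_matrix_mult_def norm_sum)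
  also have "\<dots> \<le> (\<Sum>l\<in>(UNIV::'n set). norm M * (real CARD('n) * norm M) ^ k)"
  proof (rule sum_mono)
    fix l
    have "norm (M $ i $ l) \<le> norm M"
      by (meson Finite_Cartesian_Product.norm_nth_le order_trans)
    thus "norm (M $ i $ l * matrix_power M k $ l $ j) \<le> norm M * (real CARD('n) * norm M) ^ k"
      unfolding norm_mult using Suc.IH by (intro mult_mono) auto
  qed
  also have "\<dots> = (real CARD('n) * norm M) ^ Suc k"
    by (simp add: algebra_simps)
  finally show ?case .
qed

lemma matrix_power_scale:
  fixes M :: "complex^'n^'n"
  shows "matrix_power (map_matrix ((*) z) M) k $ i $ j = z ^ k * matrix_power M k $ i $ j"
  by (induction k arbitrary: i j)
    (simp_all add: mat_def map_matrix_def matrix_matrix_mult_def sum_distrib_left mult_ac)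

lemma matrix_exp_summable:
  fixes M :: "complex^'n^'n"
  shows "summable (\<lambda>k. matrix_power M k $ i $ j / fact k * z ^ k)"
proof (rule summable_comparison_test')
  let ?c = "real CARD('n) * norm M * norm z"
  show "summable (\<lambda>k. ?c ^ k / fact k)"
    using summable_exp[of ?c] by (simp add: field_simps)
  show "norm (matrix_power M k $ i $ j / fact k * z ^ k) \<le> ?c ^ k / fact k" for k
    using mult_right_mono[OF norm_matrix_power_entry_le[of M k i j], of "norm z ^ k"]
    by (simp add: norm_mult norm_divide norm_power power_mult_distrib divide_right_mono)
qed

text \<open>Each entry becomes an everywhere convergent power series in the scalar \<open>z\<close>,
  which can be differentiated termwise and examined by the parity of the exponents.\<close>

lemma matrix_exp_entry_sums:
  fixes M :: "complex^'n^'n"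
  shows "(\<lambda>k. matrix_power M k $ i $ j / fact k * z ^ k) sums
           (matrix_exp (map_matrix ((*) z) M) $ i $ j)"
proof -
  let ?S = "\<lambda>k. (1 / fact k) *\<^sub>R matrix_power (map_matrix ((*) z) M) k"
  have entry: "?S k $ i $ j = matrix_power M k $ i $ j / fact k * z ^ k" for k i j
    by (simp add: matrix_power_scale scaleR_conv_of_real[where 'a = complex])
  have "?S sums (\<chi> i j. \<Sum>k. matrix_power M k $ i $ j / fact k * z ^ k)"
    unfolding sums_def
    by (intro vec_tendstoI)
      (use summable_sums[OF matrix_exp_summable[of M]] in \<open>simp add: sums_def entry del: vector_scaleR_component\<close>)
  hence "matrix_exp (map_matrix ((*) z) M) =
      (\<chi> i j. \<Sum>k. matrix_power M k $ i $ j / fact k * z ^ k)"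
    unfolding matrix_exp_def by (rule sums_unique[symmetric])
  thus ?thesis
    using summable_sums[OF matrix_exp_summable[of M i j z]] by simp
qed

lemma matrix_power_Suc_right: "matrix_power M (Suc k) = matrix_power M k ** M"
  by (induction k) (simp_all add: matrix_mul_assoc)

lemma matrix_mult_exp_entry_sums:
  fixes M :: "complex^'n^'n"
  shows "(\<lambda>k. matrix_power M (Suc k) $ i $ j / fact k * z ^ k) sums
           ((M ** matrix_exp (map_matrix ((*) z) M)) $ i $ j)"
proof -
  have "(\<lambda>k. \<Sum>l\<in>UNIV. M $ i $ l * (matrix_power M k $ l $ j / fact k * z ^ k)) sums
      (\<Sum>l\<in>UNIV. M $ i $ l * matrix_exp (map_matrix ((*) z) M) $ l $ j)"
    by (intro sums_sum sums_mult matrix_exp_entry_sums)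
  thus ?thesis
    by (simp add: matrix_matrix_mult_def sum_distrib_left sum_distrib_right sum_divide_distrib mult_ac)
qed

lemma matrix_exp_mult_entry_sums:
  fixes M :: "complex^'n^'n"
  shows "(\<lambda>k. matrix_power M (Suc k) $ i $ j / fact k * z ^ k) sums
           ((matrix_exp (map_matrix ((*) z) M) ** M) $ i $ j)"
proof -
  have "(\<lambda>k. \<Sum>l\<in>UNIV. (matrix_power M k $ i $ l / fact k * z ^ k) * M $ l $ j) sums
      (\<Sum>l\<in>UNIV. matrix_exp (map_matrix ((*) z) M) $ i $ l * M $ l $ j)"
    by (intro sums_sum sums_mult2 matrix_exp_entry_sums)
  thus ?thesis
    unfolding matrix_power_Suc_right
    by (simp add: matrix_matrix_mult_def sum_distrib_left sum_distrib_right sum_divide_distrib mult_ac)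
qed

text \<open>Both products have the same entrywise series, because \<open>M\<close> commutes with its
  powers.\<close>

lemma matrix_exp_commute:
  fixes M :: "complex^'n^'n"
  shows "M ** matrix_exp (map_matrix ((*) z) M) = matrix_exp (map_matrix ((*) z) M) ** M"
  unfolding vec_eq_iff
  by (intro allI sums_unique2[OF matrix_mult_exp_entry_sums matrix_exp_mult_entry_sums])

text \<open>Termwise differentiation cancels one factor of the factorial and raises the matrix power
  by one, which is the series of the product with \<open>M\<close>.\<close>

lemma matrix_exp_entry_has_derivative:
  fixes M :: "complex^'n^'n"
  shows "((\<lambda>z. matrix_exp (map_matrix ((*) z) M) $ i $ j) has_field_derivative
           (M ** matrix_exp (map_matrix ((*) z) M)) $ i $ j) (at z)"
proof -
  let ?a = "\<lambda>k. matrix_power M k $ i $ j / fact k"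
  have "diffs ?a = (\<lambda>k. matrix_power M (Suc k) $ i $ j / fact k)"
    by (auto simp: diffs_def simp del: of_nat_Suc matrix_power.simps)
  moreover have "((\<lambda>z. \<Sum>k. ?a k * z ^ k) has_field_derivative (\<Sum>k. diffs ?a k * z ^ k)) (at z)"
    by (intro termdiffs_strong_converges_everywhere matrix_exp_summable)
  ultimately show ?thesis
    using sums_unique[OF matrix_mult_exp_entry_sums[of M i j]]
      sums_unique[OF matrix_exp_entry_sums[of M i j]]
    by (simp del: matrix_power.simps)
qed

section \<open>The continuous quantum walk\<close>

lemma adjacency_matrix_sym:
  assumes "simple_graph adj"
  shows "adjacency_matrix adj $ v $ l = adjacency_matrix adj $ l $ v"
  using assms by (auto simp: simple_graph_def adjacency_matrix_def dest: sympD)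

lemma adjacency_matrix_mult_entry:
  "(adjacency_matrix adj ** M) $ v $ p = (\<Sum>l | adj v l. M $ l $ p)"
  by (simp add: adjacency_matrix_def matrix_matrix_mult_def if_distrib[of "\<lambda>x. x * _"]
      sum.If_cases cong: if_cong)

lemma transition_matrix_commute:
  "adjacency_matrix adj ** transition_matrix adj t =
   transition_matrix adj t ** adjacency_matrix adj"
  unfolding transition_matrix_def by (rule matrix_exp_commute)

section \<open>Unitarity, and the action of the adjacency matrix on the pendent column\<close>

text \<open>A column \<open>x\<close> solves x' = iAx with \<open>A\<close> Hermitian, so its
  squared norm \<open>N\<close> is constant in time; at time 0 the column is a standard basis
  vector.\<close>

lemma transition_matrix_column_norm:
  assumes "simple_graph adj"
  shows "(\<Sum>v\<in>UNIV. (cmod (transition_matrix adj t $ v $ p))\<^sup>2) = 1"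
proof -
  define A where "A = adjacency_matrix adj"
  define x where "x t v = transition_matrix adj t $ v $ p" for t v
  define N where "N t = (\<Sum>v\<in>UNIV. x t v * cnj (x t v))" for t
  have A_cnj: "cnj (A $ v $ l) = A $ l $ v" for v l
    using adjacency_matrix_sym[OF assms, of v l] by (auto simp: A_def adjacency_matrix_def)
  have dx: "((\<lambda>t. x t v) has_vector_derivative (\<i> * (\<Sum>l\<in>UNIV. A $ v $ l * x t l))) (at t)" for v t
  proof -
    have "((\<lambda>s. \<i> * of_real s) has_vector_derivative \<i>) (at t)"
      using has_vector_derivative_real_field[of "\<lambda>z. \<i> * z" \<i> t UNIV]
      by (auto intro!: derivative_eq_intros)
    from field_vector_diff_chain_at[OF this matrix_exp_entry_has_derivative[of A v p]]
    show ?thesis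
      by (simp add: x_def transition_matrix_def o_def A_def[symmetric] matrix_matrix_mult_def)
  qed
  have "(N has_vector_derivative 0) (at t)" for t
  proof -
    let ?d = "\<lambda>v. \<i> * (\<Sum>l\<in>UNIV. A $ v $ l * x t l)"
    have "(N has_vector_derivative (\<Sum>v\<in>UNIV. x t v * cnj (?d v) + ?d v * cnj (x t v))) (at t)"
      unfolding N_def
      by (intro has_vector_derivative_sum has_vector_derivative_mult has_vector_derivative_cnj dx)
    also have "(\<Sum>v\<in>UNIV. x t v * cnj (?d v) + ?d v * cnj (x t v)) = 0"
    proof -
      \<comment> \<open>Conjugation flips the sign of \<open>\<i>\<close> and transposes
        \<open>A\<close>; exchanging the two summations then restores the other half of the
        derivative.\<close>
      have "(\<Sum>v\<in>UNIV. x t v * cnj (?d v)) = - (\<Sum>v\<in>UNIV. ?d v * cnj (x t v))"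
      proof -
      have "(\<Sum>v\<in>UNIV. x t v * cnj (?d v))
          = - (\<Sum>v\<in>UNIV. \<Sum>l\<in>UNIV. \<i> * A $ l $ v * x t v * cnj (x t l))"
        by (simp add: A_cnj sum_distrib_left sum_negf mult_ac)
      also have "\<dots> = - (\<Sum>l\<in>UNIV. \<Sum>v\<in>UNIV. \<i> * A $ l $ v * x t v * cnj (x t l))"
        by (subst sum.swap) simp
      finally show ?thesis
        by (simp add: sum_distrib_left sum_distrib_right mult_ac)
      qed
      thus ?thesis
        by (simp only: sum.distrib left_minus)
    qed
    finally show ?thesis .
  qed
  then obtain c where c: "\<And>t. N t = c"
    using has_vector_derivative_zero_constant[of UNIV N] by auto
  \<comment> \<open>At time 0 only the constant term of the series survives, and it is the identity
    matrix.\<close>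
  have "x 0 v = (if v = p then 1 else 0)" for v
    using sums_unique2[OF matrix_exp_entry_sums[of A v p 0] powser_sums_zero]
    by (simp add: x_def transition_matrix_def A_def mat_def)
  hence "x 0 v * cnj (x 0 v) = (if v = p then 1 else 0)" for v
    by simp
  hence "N 0 = 1"
    by (simp add: N_def)
  hence "N t = 1"
    using c[of t] c[of 0] by simp
  moreover have "N t = of_real (\<Sum>v\<in>UNIV. (cmod (x t v))\<^sup>2)"
    by (simp add: N_def complex_norm_square del: of_real_power)
  ultimately show ?thesis
    unfolding x_def by (metis of_real_eq_1_iff)
qed

text \<open>Pendency is used here: column \<open>u\<close> of the adjacency matrix is the basis
  vector at the neighbour \<open>w\<close>. Commuting the two matrices turns the neighbour sums over
  column \<open>u\<close> into column \<open>w\<close>, which has norm 1.\<close>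

lemma pendent_neighbour_sums_norm:
  assumes "simple_graph adj" and "pendent adj u"
  shows "(\<Sum>v\<in>UNIV. (cmod (\<Sum>l | adj v l. transition_matrix adj t $ l $ u))\<^sup>2) = 1"
proof -
  obtain w where w: "{v. adj u v} = {w}"
    using assms(2) by (auto simp: pendent_def degree_def card_1_singleton_iff)
  have Au: "adjacency_matrix adj $ l $ u = (if l = w then 1 else 0)" for l
    using w adjacency_matrix_sym[OF assms(1), of l u] by (auto simp: adjacency_matrix_def)
  have "(\<Sum>l | adj v l. transition_matrix adj t $ l $ u) = transition_matrix adj t $ v $ w" for v
    unfolding adjacency_matrix_mult_entry[symmetric] transition_matrix_commute
    by (simp add: matrix_matrix_mult_def Au if_distrib cong: if_cong)
  thus ?thesis
    using transition_matrix_column_norm[OF assms(1)] by simp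
qed

section \<open>Real and imaginary entries under a two-colouring\<close>

text \<open>A nonzero entry means that a walk of length \<open>k\<close> joins \<open>v\<close> to
  \<open>p\<close>, and each step of a walk switches the colour.\<close>

lemma matrix_power_parity:
  assumes "\<And>x y. adj x y \<Longrightarrow> (x \<in> S \<longleftrightarrow> y \<notin> S)"
    and "matrix_power (adjacency_matrix adj) k $ v $ p \<noteq> 0"
  shows "even k \<longleftrightarrow> (v \<in> S \<longleftrightarrow> p \<in> S)"
  using assms(2)
proof (induction k arbitrary: v)
  case 0
  then show ?case by (simp add: mat_def split: if_splits)
next
  case (Suc k)
  then obtain l where "adj v l" "matrix_power (adjacency_matrix adj) k $ l $ p \<noteq> 0"
    by (auto simp: adjacency_matrix_mult_entry elim: sum.not_neutral_contains_not_neutral)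
  then show ?case
    using Suc.IH assms(1) by auto
qed

text \<open>The coefficients are real, and by parity an entry involves only even or only odd powers
  of \<open>\<i> * t\<close>.\<close>

lemma transition_matrix_real_or_imaginary:
  assumes "\<And>x y. adj x y \<Longrightarrow> (x \<in> S \<longleftrightarrow> y \<notin> S)"
  shows "if v \<in> S \<longleftrightarrow> p \<in> S then Im (transition_matrix adj t $ v $ p) = 0
         else Re (transition_matrix adj t $ v $ p) = 0"
proof -
  \<comment> \<open>\<open>\<sigma>\<close> equals \<open>(-1) ^ k\<close> for every
    \<open>k\<close> with a nonzero coefficient, so conjugation multiplies the whole series by
    it.\<close>
  define \<sigma> :: complex where "\<sigma> = (if v \<in> S \<longleftrightarrow> p \<in> S then 1 else -1)"
  define a where "a k = matrix_power (adjacency_matrix adj) k $ v $ p" for k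
  have real: "cnj (a k) = a k" for k
    unfolding a_def
    by (induction k arbitrary: v) (auto simp: mat_def adjacency_matrix_mult_entry)
  let ?f = "\<lambda>k. a k / fact k * (\<i> * of_real t) ^ k"
  have term_cnj: "cnj (?f k) = \<sigma> * ?f k" for k
  proof (cases "a k = 0")
    case False
    hence "\<sigma> = (-1) ^ k"
      using matrix_power_parity[OF assms, where k = k and v = v and p = p] by (auto simp: a_def \<sigma>_def)
    moreover have "cnj (fact k) = fact k"
      by (metis complex_cnj_of_nat of_nat_fact)
    ultimately show ?thesis
      using power_minus[of "\<i> * of_real t" k] by (simp add: real)
  qed (simp add: real)
  have f: "?f sums (transition_matrix adj t $ v $ p)"
    unfolding a_def transition_matrix_def by (rule matrix_exp_entry_sums)
  hence "(\<lambda>k. cnj (?f k)) sums cnj (transition_matrix adj t $ v $ p)"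
    by (simp only: sums_cnj)
  moreover have "(\<lambda>k. cnj (?f k)) sums (\<sigma> * transition_matrix adj t $ v $ p)"
    unfolding term_cnj by (intro sums_mult f)
  ultimately have "cnj (transition_matrix adj t $ v $ p) = \<sigma> * transition_matrix adj t $ v $ p"
    by (rule sums_unique2)
  thus ?thesis
    by (auto simp: \<sigma>_def complex_eq_iff split: if_splits)
qed

text \<open>The entries of \<open>U(t) e\<^sub>u\<close> are real on one colour class and imaginary on the other;
  \<open>Re + Im\<close> extracts the nonzero coordinate in both cases.\<close>

lemma pendent_real_state:
  assumes "simple_graph adj" and "pendent adj u"
    and col: "\<And>x y. adj x y \<Longrightarrow> (x \<in> S \<longleftrightarrow> y \<notin> S)"
  obtains r :: "real^'v::finite"
  where "\<And>v. (r $ v)\<^sup>2 = (cmod (transition_matrix adj t $ v $ u))\<^sup>2"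
    and "(\<Sum>v\<in>UNIV. (r $ v)\<^sup>2) = 1"
    and "(\<Sum>v\<in>UNIV. (\<Sum>l | adj v l. r $ l)\<^sup>2) = 1"
proof -
  define x where "x v = transition_matrix adj t $ v $ u" for v
  define r :: "real^'v" where "r = (\<chi> v. Re (x v) + Im (x v))"
  have part: "if v \<in> S \<longleftrightarrow> u \<in> S then Im (x v) = 0 else Re (x v) = 0" for v
    unfolding x_def by (rule transition_matrix_real_or_imaginary[OF col])
  have sq: "(Re z + Im z)\<^sup>2 = (cmod z)\<^sup>2" if "Re z = 0 \<or> Im z = 0" for z
    using that by (auto simp: cmod_power2)
  have 1: "(r $ v)\<^sup>2 = (cmod (x v))\<^sup>2" for v
    using part[of v] sq[of "x v"] by (auto simp: r_def split: if_splits)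
  \<comment> \<open>All neighbours of \<open>v\<close> share one colour, so the terms of the sum are
    all real or all imaginary and no mixed contribution arises.\<close>
  have 2: "(\<Sum>l | adj v l. r $ l)\<^sup>2 = (cmod (\<Sum>l | adj v l. x l))\<^sup>2" for v
  proof -
    have "Im (x l) = 0" if "adj v l" "v \<in> S \<longleftrightarrow> u \<notin> S" for l
      using part[of l] col[OF that(1)] that(2) by (auto split: if_splits)
    moreover have "Re (x l) = 0" if "adj v l" "v \<in> S \<longleftrightarrow> u \<in> S" for l
      using part[of l] col[OF that(1)] that(2) by (auto split: if_splits)
    ultimately have "Re (\<Sum>l | adj v l. x l) = 0 \<or> Im (\<Sum>l | adj v l. x l) = 0"
      by (cases "v \<in> S \<longleftrightarrow> u \<in> S") auto
    from sq[OF this] show ?thesis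
      by (simp add: r_def sum.distrib)
  qed
  show ?thesis
    using that[of r] 1 2 transition_matrix_column_norm[OF assms(1), of t u]
      pendent_neighbour_sums_norm[OF assms(1,2), of t]
    by (simp add: x_def)
qed

section \<open>Parity obstruction to an exactly flat state\<close>

text \<open>The handshake argument: every edge is counted once from each colour class, so the two
  classes contribute equally.\<close>

lemma bipartite_even_adjacent_pairs:
  fixes adj :: "'v::finite \<Rightarrow> 'v \<Rightarrow> bool"
  assumes "simple_graph adj" and col: "\<And>x y. adj x y \<Longrightarrow> (x \<in> S \<longleftrightarrow> y \<notin> S)"
  shows "even (\<Sum>v\<in>UNIV. card {l. adj v l})"
proof -
  have sym: "adj x y \<longleftrightarrow> adj y x" for x y
    using assms(1) by (auto simp: simple_graph_def dest: sympD)
  let ?e = "\<lambda>v l. if adj v l then 1 else (0::nat)"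
  have deg: "card {l. adj v l} = (\<Sum>l\<in>UNIV. ?e v l)" for v
    by (simp add: sum.If_cases)
  have in_S: "(\<Sum>v\<in>S. \<Sum>l\<in>UNIV. ?e v l) = (\<Sum>v\<in>S. \<Sum>l\<in>-S. ?e v l)"
    using col by (intro sum.cong refl sum.mono_neutral_right) auto
  have "(\<Sum>v\<in>-S. \<Sum>l\<in>UNIV. ?e v l) = (\<Sum>v\<in>-S. \<Sum>l\<in>S. ?e v l)"
    using col by (intro sum.cong refl sum.mono_neutral_right) auto
  also have "\<dots> = (\<Sum>l\<in>S. \<Sum>v\<in>-S. ?e v l)"
    by (rule sum.swap)
  finally have not_in_S: "(\<Sum>v\<in>-S. \<Sum>l\<in>UNIV. ?e v l) = (\<Sum>v\<in>S. \<Sum>l\<in>-S. ?e v l)"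
    by (simp add: sym)
  have "(\<Sum>v\<in>UNIV. card {l. adj v l})
      = (\<Sum>v\<in>S. \<Sum>l\<in>UNIV. ?e v l) + (\<Sum>v\<in>-S. \<Sum>l\<in>UNIV. ?e v l)"
    unfolding deg by (subst sum.union_disjoint[symmetric]) (auto simp: Compl_partition)
  thus ?thesis
    unfolding in_S not_in_S by simp
qed

lemma no_flat_real_state:
  fixes r :: "real^'v::finite"
  assumes "simple_graph adj" and col: "\<And>x y. adj x y \<Longrightarrow> (x \<in> S \<longleftrightarrow> y \<notin> S)"
    and "odd CARD('v)"
    and flat: "\<And>v. (r $ v)\<^sup>2 = 1 / real CARD('v)"
    and unit: "(\<Sum>v\<in>UNIV. (\<Sum>l | adj v l. r $ l)\<^sup>2) = 1"
  shows False
proof -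
  let ?n = "real CARD('v)"
  \<comment> \<open>Flatness forces the rescaled entry to be 1 or -1, so the default -1 is its true
    value.\<close>
  define s :: "'v \<Rightarrow> int" where "s v = (if sqrt ?n * r $ v = 1 then 1 else -1)" for v
  have s: "sqrt ?n * r $ v = of_int (s v)" for v
  proof -
    have "(sqrt ?n * r $ v)\<^sup>2 = 1"
      by (simp add: power_mult_distrib flat)
    thus ?thesis
      by (auto simp: s_def power2_eq_1_iff)
  qed
  have "of_int (\<Sum>v\<in>UNIV. (\<Sum>l | adj v l. s l)\<^sup>2)
      = (\<Sum>v\<in>UNIV. (sqrt ?n * (\<Sum>l | adj v l. r $ l))\<^sup>2)"
    by (simp add: s sum_distrib_left)
  also have "\<dots> = ?n"
    using unit by (simp add: power_mult_distrib sum_distrib_left[symmetric])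
  finally have "(\<Sum>v\<in>UNIV. (\<Sum>l | adj v l. s l)\<^sup>2) = int CARD('v)"
    by linarith
  moreover have "even (\<Sum>v\<in>UNIV. (\<Sum>l | adj v l. s l)\<^sup>2)
      \<longleftrightarrow> even (\<Sum>v\<in>UNIV. card {l. adj v l})"
  proof -
    \<comment> \<open>Every summand is odd, so the sum has the parity of the number of summands;
      squaring preserves it.\<close>
    have "even (\<Sum>l | adj v l. s l) \<longleftrightarrow> even (card {l. adj v l})" for v
      by (subst even_sum_iff) (auto simp: s_def)
    thus ?thesis
      by (subst (1 2) even_sum_iff) auto
  qed
  ultimately show False
    using bipartite_even_adjacent_pairs[OF assms(1) col] assms(3) by simp
qed

section \<open>From approximate to exact flatness\<close>

lemma mixing_entry_bound:
  fixes adj :: "'v::finite \<Rightarrow> 'v \<Rightarrow> bool"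
  assumes "local_eps_uniform_mixing adj u" and "\<epsilon> > 0"
  shows "\<exists>\<tau>. \<forall>v. \<bar>(cmod (transition_matrix adj \<tau> $ v $ u))\<^sup>2 - 1 / real CARD('v)\<bar> < \<epsilon>"
proof -
  obtain \<tau> where \<tau>: "norm ((transition_matrix adj \<tau> *v axis u 1) *
      (map_matrix cnj (transition_matrix adj \<tau>) *v axis u 1)
      - (1 / real CARD('v)) *\<^sub>R 1) < \<epsilon>" (is "norm ?d < \<epsilon>")
    using assms unfolding local_eps_uniform_mixing_def by blast
  have "?d $ v = of_real ((cmod (transition_matrix adj \<tau> $ v $ u))\<^sup>2 - 1 / real CARD('v))" for v
    by (simp add: matrix_vector_mult_def map_matrix_def axis_def if_distrib cong: if_cong)
      (simp add: complex_norm_square[unfolded of_real_power] scaleR_conv_of_real)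
  hence "\<bar>(cmod (transition_matrix adj \<tau> $ v $ u))\<^sup>2 - 1 / real CARD('v)\<bar> < \<epsilon>" for v
    using Finite_Cartesian_Product.norm_nth_le[of ?d v] \<tau> by (simp only: norm_of_real)
  thus ?thesis by blast
qed

text \<open>The real states form a compact set, so arbitrarily flat states would give an exactly flat
  one.\<close>

lemma bipartite_pendent_not_mixing:
  fixes adj :: "'v::finite \<Rightarrow> 'v \<Rightarrow> bool"
  assumes "simple_graph adj" and "odd CARD('v)" and "bipartite adj" and "pendent adj u"
  shows "\<not> local_eps_uniform_mixing adj u"
proof
  assume mix: "local_eps_uniform_mixing adj u"
  let ?n = "real CARD('v)"
  obtain S T where "S \<inter> T = {}"
    and "\<forall>x y. adj x y \<longrightarrow> (x \<in> S \<and> y \<in> T) \<or> (x \<in> T \<and> y \<in> S)"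
    using assms(3) by (auto simp: bipartite_def)
  hence col: "x \<in> S \<longleftrightarrow> y \<notin> S" if "adj x y" for x y
    using that by (meson disjoint_iff)
  \<comment> \<open>Both conditions are closed, and the first places \<open>K\<close> on the unit
    sphere. \<open>dev\<close> measures the distance from flatness; its minimum on \<open>K\<close>
    is attained and will be shown to be 0.\<close>
  define K :: "(real^'v) set" where
    "K = {r. (\<Sum>v\<in>UNIV. (r $ v)\<^sup>2) = 1} \<inter> {r. (\<Sum>v\<in>UNIV. (\<Sum>l | adj v l. r $ l)\<^sup>2) = 1}"
  define dev where "dev r = (\<Sum>v\<in>UNIV. \<bar>(r $ v)\<^sup>2 - 1 / ?n\<bar>)" for r :: "real^'v"
  have "closed K"
    unfolding K_def by (intro closed_Int closed_Collect_eq continuous_intros)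
  moreover have "bounded K"
    unfolding bounded_iff
    by (intro exI[of _ 1]) (auto simp: K_def norm_vec_def L2_set_def)
  ultimately have "compact K"
    by (simp add: compact_eq_bounded_closed)
  moreover have flat_states: "\<exists>r\<in>K. dev r \<le> ?n * \<epsilon>" if "\<epsilon> > 0" for \<epsilon>
  proof -
    obtain \<tau> where \<tau>: "\<bar>(cmod (transition_matrix adj \<tau> $ v $ u))\<^sup>2 - 1 / ?n\<bar> < \<epsilon>" for v
      using mixing_entry_bound[OF mix \<open>\<epsilon> > 0\<close>] by blast
    obtain r :: "real^'v" where
      r: "\<And>v. (r $ v)\<^sup>2 = (cmod (transition_matrix adj \<tau> $ v $ u))\<^sup>2" "r \<in> K"
      using pendent_real_state[OF assms(1,4) col, of \<tau>] unfolding K_def by blast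
    have "dev r \<le> (\<Sum>v\<in>(UNIV::'v set). \<epsilon>)"
      unfolding dev_def r(1) using \<tau> by (intro sum_mono less_imp_le)
    thus ?thesis
      using r(2) by auto
  qed
  moreover have "continuous_on K dev"
    unfolding dev_def by (intro continuous_intros)
  moreover have "K \<noteq> {}"
    using flat_states[of 1] by auto
  ultimately obtain r where r: "r \<in> K" "\<And>r'. r' \<in> K \<Longrightarrow> dev r \<le> dev r'"
    using continuous_attains_inf[of K dev] by auto
  have "dev r \<le> 0"
  proof (rule ccontr)
    assume "\<not> dev r \<le> 0"
    \<comment> \<open>This tolerance bounds the new deviation by half of the supposedly minimal
      one.\<close>
    then obtain r' where "r' \<in> K" "dev r' \<le> ?n * (dev r / (2 * ?n))"
      using flat_states[of "dev r / (2 * ?n)"] by auto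
    thus False
      using r(2)[of r'] \<open>\<not> dev r \<le> 0\<close> by simp
  qed
  moreover have "\<bar>(r $ v)\<^sup>2 - 1 / ?n\<bar> \<le> dev r" for v
    unfolding dev_def by (rule member_le_sum) auto
  ultimately have "(r $ v)\<^sup>2 = 1 / ?n" for v
    by (meson abs_le_zero_iff eq_iff_diff_eq_0 order_trans)
  thus False
    using no_flat_real_state[OF assms(1) col assms(2)] r(1) unfolding K_def by blast
qed

theorem corollary24:
  fixes adj :: "'v::finite \<Rightarrow> 'v \<Rightarrow> bool"
  assumes "simple_graph adj" and "connected_graph adj" and "odd CARD('v)"
  shows "(bipartite adj \<longrightarrow>
            (\<forall>u. pendent adj u \<longrightarrow> \<not> local_eps_uniform_mixing adj u)) \<and>
         (tree adj \<or> (bipartite adj \<and> unicyclic adj \<and> \<not> cycle_graph adj) \<longrightarrow>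
            (\<forall>u. pendent adj u \<longrightarrow> \<not> local_eps_uniform_mixing adj u))"
  \<comment> \<open>Trees reduce to the bipartite case; the unicyclic graphs are bipartite by
    assumption.\<close>
  using bipartite_pendent_not_mixing[OF assms(1,3)] tree_imp_bipartite[of adj] by blast

end
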